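(* Let $L$ be a field containing $\mathbb{F}_q$, let $K/L$ be a finite Galois extension with $G=\mathrm{Gal}(K/L)$, and let $d\ge1$. Let $c:G\to\mathrm{GL}_d(K[\tau])$, $\sigma\mapsto c_\sigma$, be a map which satisfies $c_{\sigma\delta}=\sigma(c_\delta)c_\sigma$ for all $\sigma,\delta\in G$. Then there is a matrix $S\in\mathrm{GL}_d(K[\tau])$ such that $c_\sigma=(\sigma S)^{-1}S$ for all $\sigma\in G$.
   Context: $K[\tau]$ is the skew polynomial ring with the commutation relation $\tau b=b^q\tau$ for $b\in K$. $\mathrm{GL}_d(K[\tau])$ is the group of units of the matrix ring $M_d(K[\tau])$. The group $G$ acts on $K[\tau]$ via its action on the coefficients of polynomials, and on $M_d(K[\tau])$ by acting on the entries of matrices. (In the paper, $L$ is an $A$-field with $\mathrm{char}_A(L)\nmid\mathfrak{r}(D)$ throughout the section; the statement involves only the structure of $L$ as a field containing $\mathbb{F}_q$.) *)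

theory Defs
  imports "HOL-Analysis.Analysis"
begin

definition (in field) is_subfield :: "'a set \<Rightarrow> bool" where
  "is_subfield F \<longleftrightarrow>
     0 \<in> F \<and> 1 \<in> F \<and>
     (\<forall>x\<in>F. \<forall>y\<in>F. x + y \<in> F \<and> x * y \<in> F) \<and>
     (\<forall>x\<in>F. - x \<in> F \<and> inverse x \<in> F)"

text \<open>A field together with a finite subfield \<open>\<bbbF>\<^sub>q\<close>. As \<open>q\<close> is a parameter of the class, the
  skew polynomials over such a field form a type of class \<^class>\<open>ring_1\<close>.\<close>

class field_over_Fq = field +
  fixes Fq :: "'a set"
  assumes is_subfield_Fq: "is_subfield Fq"
    and finite_Fq: "finite Fq"

definition frob :: "'a::field_over_Fq \<Rightarrow> 'a" where
  "frob x = x ^ card (Fq :: 'a set)"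

lemma Fq_pow_q:
  fixes a :: "'a::field_over_Fq"
  assumes "a \<in> Fq"
  shows "a ^ card (Fq :: 'a set) = a"
proof (cases "a = 0")
  case True
  have "card (Fq :: 'a set) > 0"
    using finite_Fq assms by (auto simp: card_gt_0_iff)
  then show ?thesis using True by simp
next
  case False
  let ?U = "Fq - {0 :: 'a}"
  have S: "x * y \<in> Fq" "inverse x \<in> Fq" if "x \<in> Fq" "y \<in> Fq" for x y :: 'a
    using is_subfield_Fq that by (auto simp: is_subfield_def)
  have fin: "finite ?U" using finite_Fq by simp
  have "bij_betw (\<lambda>x. a * x) ?U ?U"
  proof (rule bij_betw_byWitness[where f' = "\<lambda>x. inverse a * x"])
    show "\<forall>x\<in>?U. inverse a * (a * x) = x" "\<forall>x\<in>?U. a * (inverse a * x) = x"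
      using False by (auto simp: field_simps)
    show "(*) a ` ?U \<subseteq> ?U" "(*) (inverse a) ` ?U \<subseteq> ?U"
      using False assms by (auto intro!: S)
  qed
  then have "(\<Prod>x\<in>?U. a * x) = \<Prod>?U"
    by (rule prod.reindex_bij_betw)
  moreover have "(\<Prod>x\<in>?U. a * x) = a ^ card ?U * \<Prod>?U"
    by (simp add: prod.distrib)
  moreover have "\<Prod>?U \<noteq> 0"
    using fin by simp
  ultimately have "a ^ card ?U = 1" by simp
  moreover have "card (Fq :: 'a set) = Suc (card ?U)"
    using is_subfield_Fq[where 'a = 'a] by (intro card.remove finite_Fq) (simp add: is_subfield_def)
  ultimately show ?thesis by simp
qed

lemma card_Fq_gt_1: "card (Fq :: 'a::field_over_Fq set) > 1"
proof -
  have "{0, 1 :: 'a} \<subseteq> Fq"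
    using is_subfield_Fq by (auto simp: is_subfield_def)
  from card_mono[OF finite_Fq this] show ?thesis by simp
qed

text \<open>The middle binomial coefficients vanish because \<open>(X + 1)\<^sup>q - X\<^sup>q - 1\<close> has degree less than \<open>q\<close>
  and is zero on \<open>\<bbbF>\<^sub>q\<close>.\<close>

lemma binomial_q_eq_0:
  assumes "0 < i" "i < card (Fq :: 'a::field_over_Fq set)"
  shows "of_nat (card (Fq :: 'a set) choose i) = (0 :: 'a)"
proof -
  define q where "q = card (Fq :: 'a set)"
  define D :: "'a poly" where "D = (\<Sum>i\<in>{1..<q}. monom (of_nat (q choose i)) i)"
  have q1: "q > 1" unfolding q_def by (rule card_Fq_gt_1)
  have split: "{..q} = insert 0 (insert q {1..<q})" using q1 by auto
  have root: "poly D x = 0" if "x \<in> Fq" for x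
  proof -
    have "x + 1 \<in> Fq" using is_subfield_Fq that by (auto simp: is_subfield_def)
    then have "(x + 1) ^ q = x + 1" "x ^ q = x"
      using that Fq_pow_q unfolding q_def by auto
    moreover have "(x + 1) ^ q = (\<Sum>k\<le>q. of_nat (q choose k) * x ^ k)"
      by (simp add: binomial_ring)
    moreover have "\<dots> = 1 + (x ^ q + poly D x)"
      using q1 by (simp add: split D_def poly_sum poly_monom)
    ultimately show ?thesis by simp
  qed
  have "degree D < q"
    unfolding D_def using q1
    by (intro le_less_trans[OF degree_sum_le[where n = "q - 1"]]) 
       (auto intro: order.trans[OF degree_monom_le])
  have "D = 0"
  proof (rule ccontr)
    assume "D \<noteq> 0"
    have "q \<le> card {x. poly D x = 0}"
      unfolding q_def using root \<open>D \<noteq> 0\<close> by (intro card_mono poly_roots_finite) auto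
    also have "\<dots> \<le> degree D"
      using \<open>D \<noteq> 0\<close> by (rule card_poly_roots_bound)
    finally show False using \<open>degree D < q\<close> by simp
  qed
  then have "coeff D i = 0" by simp
  moreover have "coeff D i = of_nat (q choose i)"
    using assms by (auto simp: D_def q_def coeff_sum if_distrib cong: if_cong)
  ultimately show ?thesis by (simp add: q_def)
qed

lemma frob_add: "frob (x + y) = frob x + frob (y :: 'a::field_over_Fq)"
proof -
  let ?q = "card (Fq :: 'a set)"
  have split: "{..?q} = insert 0 (insert ?q {1..<?q})"
    using card_Fq_gt_1[where 'a = 'a] by auto
  have "(\<Sum>k\<in>{1..<?q}. of_nat (?q choose k) * x ^ k * y ^ (?q - k)) = 0"
    using binomial_q_eq_0[where 'a = 'a] by (intro sum.neutral) auto
  moreover have "?q \<noteq> 0" using card_Fq_gt_1[where 'a = 'a] by simp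
  ultimately show ?thesis
    unfolding frob_def binomial_ring split by (simp add: add.commute)
qed

lemma frob_simps [simp]:
  "frob (0 :: 'a::field_over_Fq) = 0" "frob (1 :: 'a) = 1"
  using card_Fq_gt_1[where 'a = 'a] by (auto simp: frob_def)

lemma frob_mult: "frob (x * y) = frob x * frob (y :: 'a::field_over_Fq)"
  by (simp add: frob_def power_mult_distrib)

lemma funpow_frob: "(frob ^^ i) x = x ^ (card (Fq :: 'a set) ^ i)" for x :: "'a::field_over_Fq"
  by (induction i) (simp_all add: frob_def mult.commute flip: power_mult)

lemma funpow_frob_simps [simp]:
  "(frob ^^ i) (0 :: 'a::field_over_Fq) = 0" "(frob ^^ i) (1 :: 'a) = 1"
  by (induction i) simp_all

lemma funpow_frob_add: "(frob ^^ i) (x + y) = (frob ^^ i) x + (frob ^^ i) (y :: 'a::field_over_Fq)"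
  by (induction i) (simp_all add: frob_add)

lemma funpow_frob_mult: "(frob ^^ i) (x * y) = (frob ^^ i) x * (frob ^^ i) (y :: 'a::field_over_Fq)"
  by (induction i) (simp_all add: frob_mult)

lemma funpow_frob_sum: "(frob ^^ i) (\<Sum>x\<in>A. f x) = (\<Sum>x\<in>A. (frob ^^ i) (f x :: 'a::field_over_Fq))"
  by (induction A rule: infinite_finite_induct) (simp_all add: funpow_frob_add)


text \<open>The element \<open>\<Sum>i. a\<^sub>i \<tau>\<^sup>i\<close> of \<open>K[\<tau>]\<close> is represented by the polynomial with coefficients \<open>a\<^sub>i\<close>
  (written to the left of the powers of \<open>\<tau>\<close>).\<close>

typedef (overloaded) 'a skew_poly = "UNIV :: 'a::zero poly set"
  morphisms poly_of_skew skew_of_poly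
  by simp

setup_lifting type_definition_skew_poly

lift_definition skew_coeff :: "'a::zero skew_poly \<Rightarrow> nat \<Rightarrow> 'a" is coeff .

lift_definition skew_const :: "'a::zero \<Rightarrow> 'a skew_poly" is "\<lambda>a. [:a:]" .

lift_definition tau :: "'a::zero_neq_one skew_poly" is "[:0, 1:]" .

lemma skew_poly_eqI: "(\<And>n. skew_coeff p n = skew_coeff r n) \<Longrightarrow> p = r"
  by transfer (rule poly_eqI)

instantiation skew_poly :: (field_over_Fq) ring_1
begin

lift_definition zero_skew_poly :: "'a skew_poly" is 0 .
lift_definition one_skew_poly :: "'a skew_poly" is 1 .
lift_definition plus_skew_poly :: "'a skew_poly \<Rightarrow> 'a skew_poly \<Rightarrow> 'a skew_poly" is "(+)" .
lift_definition minus_skew_poly :: "'a skew_poly \<Rightarrow> 'a skew_poly \<Rightarrow> 'a skew_poly" is "(-)" .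
lift_definition uminus_skew_poly :: "'a skew_poly \<Rightarrow> 'a skew_poly" is uminus .

text \<open>\<open>(a\<^sub>i \<tau>\<^sup>i) (b\<^sub>j \<tau>\<^sup>j) = a\<^sub>i b\<^sub>j\<^bsup>q^i\<^esup> \<tau>\<^bsup>i+j\<^esup>\<close>\<close>

lift_definition times_skew_poly :: "'a skew_poly \<Rightarrow> 'a skew_poly \<Rightarrow> 'a skew_poly" is
  "\<lambda>p r. \<Sum>i\<le>degree p. \<Sum>j\<le>degree r.
     monom (coeff p i * coeff r j ^ (card (Fq :: 'a set) ^ i)) (i + j)" .

lemma skew_coeff_zero: "skew_coeff (0 :: 'a skew_poly) n = 0"
  by transfer simp

lemma skew_coeff_one: "skew_coeff (1 :: 'a skew_poly) n = (if n = 0 then 1 else 0)"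
  by transfer simp

lemma skew_coeff_add: "skew_coeff (p + r :: 'a skew_poly) n = skew_coeff p n + skew_coeff r n"
  by transfer simp

lemma skew_coeff_mult:
  "skew_coeff (p * r :: 'a skew_poly) n =
     (\<Sum>i\<le>n. skew_coeff p i * (frob ^^ i) (skew_coeff r (n - i)))"
proof (transfer fixing: n)
  fix p r :: "'a poly"
  let ?f = "\<lambda>i j. coeff p i * (frob ^^ i) (coeff r j)"
  have inner: "(\<Sum>j\<le>degree r. coeff (monom (?f i j) (i + j)) n) = (if i \<le> n then ?f i (n - i) else 0)" for i
  proof (cases "i \<le> n")
    case True
    have "(\<Sum>j\<le>degree r. coeff (monom (?f i j) (i + j)) n) =
          (\<Sum>j\<le>degree r. if j = n - i then ?f i j else 0)"
      using True by (intro sum.cong) auto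
    also have "\<dots> = ?f i (n - i)"
      by (auto simp: coeff_eq_0)
    finally show ?thesis using True by simp
  qed auto
  have "coeff (\<Sum>i\<le>degree p. \<Sum>j\<le>degree r. monom (?f i j) (i + j)) n =
        (\<Sum>i\<le>degree p. if i \<le> n then ?f i (n - i) else 0)"
    by (simp only: coeff_sum inner)
  also have "\<dots> = (\<Sum>i\<in>{..degree p} \<inter> {..n}. ?f i (n - i))"
    by (simp add: sum.If_cases Int_def)
  also have "\<dots> = (\<Sum>i\<le>n. ?f i (n - i))"
    by (intro sum.mono_neutral_left) (auto simp: coeff_eq_0)
  finally show "coeff (\<Sum>i\<le>degree p. \<Sum>j\<le>degree r.
      monom (coeff p i * coeff r j ^ (card (Fq :: 'a set) ^ i)) (i + j)) n = (\<Sum>i\<le>n. ?f i (n - i))"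
    by (simp add: funpow_frob)
qed

instance
proof
  fix a b c :: "'a skew_poly"
  show "a + b + c = a + (b + c)" "a + b = b + a" "0 + a = a" "- a + a = 0" "a - b = a + - b"
    by (transfer; simp)+
  show "(0 :: 'a skew_poly) \<noteq> 1"
    by transfer simp
  show "1 * a = a"
  proof (rule skew_poly_eqI)
    fix n
    have "skew_coeff (1 * a) n = (\<Sum>i\<le>n. if i = 0 then skew_coeff a n else 0)"
      unfolding skew_coeff_mult by (intro sum.cong) (auto simp: skew_coeff_one)
    then show "skew_coeff (1 * a) n = skew_coeff a n" by simp
  qed
  show "a * 1 = a"
  proof (rule skew_poly_eqI)
    fix n
    have "skew_coeff (a * 1) n = (\<Sum>i\<le>n. if i = n then skew_coeff a n else 0)"
      unfolding skew_coeff_mult by (intro sum.cong) (auto simp: skew_coeff_one)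
    then show "skew_coeff (a * 1) n = skew_coeff a n" by simp
  qed
  show "(a + b) * c = a * c + b * c" "a * (b + c) = a * b + a * c"
    by (rule skew_poly_eqI;
        simp add: skew_coeff_mult skew_coeff_add funpow_frob_add algebra_simps sum.distrib)+
  show "a * b * c = a * (b * c)"
  proof (rule skew_poly_eqI)
    fix n
    let ?g = "\<lambda>i j k. skew_coeff a i * (frob ^^ i) (skew_coeff b j) * (frob ^^ (i + j)) (skew_coeff c k)"
    have "skew_coeff (a * b * c) n = (\<Sum>m\<le>n. \<Sum>i\<le>m. ?g i (m - i) (n - m))"
      unfolding skew_coeff_mult sum_distrib_right by (intro sum.cong) auto
    also have "\<dots> = (\<Sum>i\<le>n. \<Sum>j\<le>n - i. ?g i j (n - i - j))"
      unfolding sum.Sigma[OF finite_atMost, simplified]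
      by (subst (1 2) sum.Sigma, simp, simp, simp, simp,
          rule sum.reindex_bij_witness[where i = "\<lambda>(i, j). (i + j, i)" and j = "\<lambda>(m, i). (i, m - i)"])
         auto
    also have "\<dots> = skew_coeff (a * (b * c)) n"
      unfolding skew_coeff_mult funpow_frob_sum sum_distrib_left funpow_frob_mult
      by (intro sum.cong) (auto simp: funpow_add mult.assoc)
    finally show "skew_coeff (a * b * c) n = skew_coeff (a * (b * c)) n" .
  qed
qed

end

lemma skew_coeff_const: "skew_coeff (skew_const a) n = (if n = 0 then a else 0)"
  by transfer (auto simp: coeff_pCons split: nat.splits)

lemma skew_coeff_tau: "skew_coeff tau n = (if n = 1 then 1 else 0)"
  by transfer (auto simp: coeff_pCons split: nat.splits)

lemma tau_mult_const:
  "tau * skew_const b = skew_const (b ^ card (Fq :: 'a set)) * (tau :: 'a::field_over_Fq skew_poly)"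
proof (rule skew_poly_eqI)
  fix n
  have "skew_coeff (tau * skew_const b) n = (\<Sum>i\<le>n. if i = 1 then (if n = 1 then frob b else 0) else 0)"
    unfolding skew_coeff_mult by (intro sum.cong) (auto simp: skew_coeff_tau skew_coeff_const)
  moreover have "skew_coeff (skew_const (frob b) * tau) n =
      (\<Sum>i\<le>n. if i = 0 then (if n = 1 then frob b else 0) else 0)"
    unfolding skew_coeff_mult by (intro sum.cong) (auto simp: skew_coeff_tau skew_coeff_const)
  ultimately show "skew_coeff (tau * skew_const b) n =
      skew_coeff (skew_const (b ^ card (Fq :: 'a set)) * tau) n"
    by (simp add: frob_def)
qed

text \<open>Action of an endomorphism of \<open>K\<close> on coefficients.\<close>

lift_definition skew_map :: "('a::zero \<Rightarrow> 'a) \<Rightarrow> 'a skew_poly \<Rightarrow> 'a skew_poly" is map_poly .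

lemma skew_coeff_map: "\<sigma> 0 = 0 \<Longrightarrow> skew_coeff (skew_map \<sigma> p) n = \<sigma> (skew_coeff p n)"
  by transfer (simp add: coeff_map_poly)


text \<open>In the following \<open>K\<close> is the type \<^typ>\<open>'a\<close> and \<open>L\<close> is a subset of it.\<close>

definition Gal :: "'a::field set \<Rightarrow> ('a \<Rightarrow> 'a) set" where
  "Gal L = {\<sigma>. bij \<sigma> \<and> (\<forall>x y. \<sigma> (x + y) = \<sigma> x + \<sigma> y) \<and> (\<forall>x y. \<sigma> (x * y) = \<sigma> x * \<sigma> y) \<and>
              (\<forall>x\<in>L. \<sigma> x = x)}"

definition finite_extension :: "'a::field set \<Rightarrow> bool" where
  "finite_extension L \<longleftrightarrow>
     is_subfield L \<and>
     (\<exists>B. finite B \<and> (\<forall>x. \<exists>a. (\<forall>b\<in>B. a b \<in> L) \<and> x = (\<Sum>b\<in>B. a b * b)))"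

text \<open>Galois in the sense of Artin: \<open>L\<close> is the fixed field of \<open>Aut(K/L)\<close>.\<close>

definition finite_Galois_extension :: "'a::field set \<Rightarrow> bool" where
  "finite_Galois_extension L \<longleftrightarrow>
     finite_extension L \<and> {x. \<forall>\<sigma>\<in>Gal L. \<sigma> x = x} = L"

end

theory Submission
  imports Defs "HOL-Library.Function_Algebras"
begin

text \<open>Let \<open>M = K[\<tau>]\<^sup>d\<close> be the module of row vectors.  The formula \<open>\<sigma> * v = \<sigma>(v) c\<^sub>\<sigma>\<close> defines a semilinear
  action of \<open>G\<close> on \<open>M\<close>, and an invertible \<open>S\<close> satisfies \<open>c\<^sub>\<sigma> = (\<sigma> S)\<^sup>-\<^sup>1 S\<close> iff its rows are fixed by this
  action; so a \<open>K[\<tau>]\<close>-basis of \<open>M\<close> consisting of fixed vectors is needed.  By Galois descent the fixed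
  vectors generate \<open>M\<close>.  Among the finite generating sets of fixed vectors take one of minimal total
  degree.  A linear relation between its nonzero elements would give a relation between top
  coefficients; although \<open>K\<close> need not be perfect, this relation descends to one with coefficients in
  \<open>L\<close> in which a vector of maximal degree has coefficient 1, and that vector could be replaced by one
  of smaller degree.\<close>

section \<open>Field automorphisms\<close>

lemma Gal_add: "\<sigma> \<in> Gal L \<Longrightarrow> \<sigma> (x + y) = \<sigma> x + \<sigma> y"
  and Gal_mult: "\<sigma> \<in> Gal L \<Longrightarrow> \<sigma> (x * y) = \<sigma> x * \<sigma> y"
  and Gal_bij: "\<sigma> \<in> Gal L \<Longrightarrow> bij \<sigma>"
  and Gal_fixes: "\<sigma> \<in> Gal L \<Longrightarrow> x \<in> L \<Longrightarrow> \<sigma> x = x"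
  by (auto simp: Gal_def)

lemma Gal_zero: "\<sigma> \<in> Gal L \<Longrightarrow> \<sigma> 0 = 0"
  using Gal_add[of \<sigma> L 0 0] by (metis add.right_neutral add_left_cancel)

lemma Gal_eq_0_iff: "\<sigma> \<in> Gal L \<Longrightarrow> \<sigma> x = 0 \<longleftrightarrow> x = 0"
  using Gal_zero[of \<sigma> L] Gal_bij[of \<sigma> L] by (metis bij_is_inj injD)

lemma Gal_one: "\<sigma> \<in> Gal L \<Longrightarrow> \<sigma> 1 = 1"
  using Gal_mult[of \<sigma> L 1 1] Gal_eq_0_iff[of \<sigma> L 1] by simp

lemma Gal_sum:
  assumes "\<sigma> \<in> Gal L"
  shows "\<sigma> (\<Sum>x\<in>A. f x) = (\<Sum>x\<in>A. \<sigma> (f x))"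
  by (induction A rule: infinite_finite_induct) (simp_all add: Gal_add[OF assms] Gal_zero[OF assms])

lemma Gal_power:
  assumes "\<sigma> \<in> Gal L"
  shows "\<sigma> (x ^ n) = \<sigma> x ^ n"
  by (induction n) (simp_all add: Gal_mult[OF assms] Gal_one[OF assms])

lemma Gal_inverse:
  assumes "\<sigma> \<in> Gal L"
  shows "\<sigma> (inverse x) = inverse (\<sigma> x)"
proof (cases "x = 0")
  case False
  then have "\<sigma> x * \<sigma> (inverse x) = 1"
    by (simp add: Gal_one[OF assms] flip: Gal_mult[OF assms])
  then show ?thesis by (simp add: inverse_unique)
qed (simp add: Gal_zero[OF assms])

lemma Gal_id: "id \<in> Gal L"
  by (simp add: Gal_def)

lemma Gal_comp: "\<sigma> \<in> Gal L \<Longrightarrow> \<delta> \<in> Gal L \<Longrightarrow> \<sigma> \<circ> \<delta> \<in> Gal L"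
  by (auto simp: Gal_def bij_comp)

lemma Gal_inv:
  assumes "\<sigma> \<in> Gal L"
  shows "inv \<sigma> \<in> Gal L"
proof -
  have s: "\<sigma> (inv \<sigma> x) = x" for x
    by (simp add: Gal_bij[OF assms] bij_is_surj surj_f_inv_f)
  note inj = bij_is_inj[OF Gal_bij[OF assms]]
  have "inv \<sigma> (x + y) = inv \<sigma> x + inv \<sigma> y" "inv \<sigma> (x * y) = inv \<sigma> x * inv \<sigma> y" for x y
    by (auto intro!: inv_f_eq inj simp: s Gal_add[OF assms] Gal_mult[OF assms])
  moreover have "inv \<sigma> x = x" if "x \<in> L" for x
    using that by (intro inv_f_eq inj Gal_fixes[OF assms])
  ultimately show ?thesis
    unfolding Gal_def using Gal_bij[OF assms] by (auto simp: bij_imp_bij_inv)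
qed

lemma Gal_inv_apply: "\<sigma> \<in> Gal L \<Longrightarrow> inv \<sigma> (\<sigma> x) = x" "\<sigma> \<in> Gal L \<Longrightarrow> \<sigma> (inv \<sigma> x) = x"
  by (simp_all add: Gal_bij bij_is_inj bij_is_surj surj_f_inv_f)

lemma Gal_funpow_frob: "\<sigma> \<in> Gal L \<Longrightarrow> \<sigma> ((frob ^^ i) x) = (frob ^^ i) (\<sigma> x)"
  unfolding funpow_frob by (rule Gal_power)

lemma bij_betw_Gal_comp:
  assumes "\<sigma> \<in> Gal L"
  shows "bij_betw ((\<circ>) \<sigma>) (Gal L) (Gal L)"
proof (rule bij_betw_byWitness[where f' = "(\<circ>) (inv \<sigma>)"])
  show "\<forall>\<delta>\<in>Gal L. inv \<sigma> \<circ> (\<sigma> \<circ> \<delta>) = \<delta>" "\<forall>\<delta>\<in>Gal L. \<sigma> \<circ> (inv \<sigma> \<circ> \<delta>) = \<delta>"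
    by (auto simp: fun_eq_iff Gal_inv_apply[OF assms])
qed (auto intro!: Gal_comp assms Gal_inv)

section \<open>Independence of automorphisms and finiteness of the Galois group\<close>

text \<open>Lagrange interpolation on a finite set of maps: for each \<open>\<rho>\<close> in
  \<open>R\<close>, multiply by an affine function of \<open>\<delta> b\<close> that is 1 at
  \<open>\<sigma>\<close> and 0 at \<open>\<rho>\<close>. It serves both Dedekind independence and
  Galois descent.\<close>

lemma interpolation_closed:
  fixes P :: "(('k::field \<Rightarrow> 'k) \<Rightarrow> 'k) \<Rightarrow> bool"
  assumes "finite R" "\<sigma> \<notin> R" "P f"
    and closed: "\<And>f u w b. P f \<Longrightarrow> P (\<lambda>\<delta>. f \<delta> * (u * \<delta> b + w))"
  shows "\<exists>h. P h \<and> h \<sigma> = f \<sigma> \<and> (\<forall>\<delta>\<in>R. h \<delta> = 0)"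
  using assms(1,2)
proof (induction R)
  case empty
  then show ?case using assms(3) by auto
next
  case (insert \<rho> R)
  then obtain h where h: "P h" "h \<sigma> = f \<sigma>" "\<forall>\<delta>\<in>R. h \<delta> = 0" by auto
  from insert.prems obtain b where b: "\<sigma> b \<noteq> \<rho> b" by auto
  define u where "u = 1 / (\<sigma> b - \<rho> b)"
  have "u * \<sigma> b + - u * \<rho> b = 1" "u * \<rho> b + - u * \<rho> b = 0"
    using b by (simp_all add: u_def diff_divide_distrib[symmetric])
  with closed[OF h(1), of u b "- u * \<rho> b"] h(2,3) show ?case
    by (intro exI[of _ "\<lambda>\<delta>. h \<delta> * (u * \<delta> b + - u * \<rho> b)"]) auto
qed

text \<open>Dedekind's theorem. Substituting \<open>b * x\<close> for \<open>x\<close> shows that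
  the coefficient families of relations are closed under the factors
  \<open>u * \<delta> b + w\<close>. Interpolation then isolates the term at
  \<open>\<sigma>\<close>, and \<open>x = 1\<close> reads off its coefficient.\<close>

lemma Gal_independent:
  assumes R: "finite R" "R \<subseteq> Gal L" and "\<And>x. (\<Sum>\<sigma>\<in>R. a \<sigma> * \<sigma> x) = 0" and "\<sigma> \<in> R"
  shows "a \<sigma> = 0"
proof -
  let ?P = "\<lambda>f. \<forall>x. (\<Sum>\<delta>\<in>R. f \<delta> * \<delta> x) = 0"
  have mult: "\<delta> (b * x) = \<delta> b * \<delta> x" if "\<delta> \<in> R" for \<delta> b x
    using Gal_mult R(2) that by blast
  have closed: "?P (\<lambda>\<delta>. f \<delta> * (u * \<delta> b + w))" if f: "?P f" for f u w b
  proof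
    fix x
    have "(\<Sum>\<delta>\<in>R. f \<delta> * (u * \<delta> b + w) * \<delta> x) = u * (\<Sum>\<delta>\<in>R. f \<delta> * \<delta> (b * x)) + w * (\<Sum>\<delta>\<in>R. f \<delta> * \<delta> x)"
      unfolding sum_distrib_left sum.distrib[symmetric]
      by (intro sum.cong refl) (auto simp: mult algebra_simps)
    then show "(\<Sum>\<delta>\<in>R. f \<delta> * (u * \<delta> b + w) * \<delta> x) = 0"
      using f by simp
  qed
  from interpolation_closed[of "R - {\<sigma>}" \<sigma> ?P a] R(1) assms(3)
  obtain h where h: "?P h" "h \<sigma> = a \<sigma>" "\<forall>\<delta>\<in>R - {\<sigma>}. h \<delta> = 0"
    using closed by auto
  have "(\<Sum>\<delta>\<in>R. h \<delta> * \<delta> 1) = h \<sigma> * \<sigma> 1"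
    using R(1) \<open>\<sigma> \<in> R\<close> h(3) by (subst sum.remove[of _ \<sigma>]) auto
  then show ?thesis
    using h(1,2) R(2) \<open>\<sigma> \<in> R\<close> Gal_one[of \<sigma> L] by auto
qed

text \<open>Every \<open>\<sigma>\<close> fixes the coordinates in \<open>L\<close> of each element,
  so it is a \<open>K\<close>-linear combination of the finitely many coordinate functions. An
  independent set in their span is finite.\<close>

lemma finite_Gal:
  fixes L :: "'k::field set"
  assumes "finite_extension L"
  shows "finite (Gal L)"
proof -
  define scale :: "'k \<Rightarrow> ('k \<Rightarrow> 'k) \<Rightarrow> 'k \<Rightarrow> 'k" where "scale a f = (\<lambda>x. a * f x)" for a f
  interpret V: vector_space scale
    by unfold_locales (auto simp: scale_def algebra_simps)
  obtain B a where B: "finite B" "\<And>x b. b \<in> B \<Longrightarrow> a x b \<in> L" "\<And>x. x = (\<Sum>b\<in>B. a x b * b)"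
    using assms unfolding finite_extension_def by metis
  have sum_apply: "(\<Sum>x\<in>S. f x) y = (\<Sum>x\<in>S. f x y)" for f :: "('k \<Rightarrow> 'k) \<Rightarrow> 'k \<Rightarrow> 'k" and S y
    by (induction S rule: infinite_finite_induct) auto
  have sum_apply': "(\<Sum>x\<in>S. f x) y = (\<Sum>x\<in>S. f x y)" for f :: "'k \<Rightarrow> 'k \<Rightarrow> 'k" and S y
    by (induction S rule: infinite_finite_induct) auto
  have "Gal L \<subseteq> V.span ((\<lambda>b x. a x b) ` B)"
  proof
    fix \<sigma> assume \<sigma>: "\<sigma> \<in> Gal L"
    have "\<sigma> x = (\<Sum>b\<in>B. \<sigma> b * a x b)" for x
    proof -
      have "\<sigma> x = \<sigma> (\<Sum>b\<in>B. a x b * b)" by (rule arg_cong[OF B(3)])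
      also have "\<dots> = (\<Sum>b\<in>B. \<sigma> b * a x b)"
        unfolding Gal_sum[OF \<sigma>]
        by (intro sum.cong) (simp_all add: Gal_mult[OF \<sigma>] Gal_fixes[OF \<sigma> B(2)])
      finally show ?thesis .
    qed
    then have eq: "\<sigma> = (\<Sum>b\<in>B. scale (\<sigma> b) (\<lambda>x. a x b))"
      unfolding fun_eq_iff sum_apply' scale_def by blast
    have "(\<Sum>b\<in>B. scale (\<sigma> b) (\<lambda>x. a x b)) \<in> V.span ((\<lambda>b x. a x b) ` B)"
      by (intro V.span_sum V.span_scale V.span_base imageI)
    then show "\<sigma> \<in> V.span ((\<lambda>b x. a x b) ` B)"
      unfolding eq[symmetric] .
  qed
  moreover have "V.independent (Gal L)"
    unfolding V.independent_explicit_finite_subsets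
  proof (intro allI impI ballI)
    fix S u v
    assume *: "S \<subseteq> Gal L" "finite S" "(\<Sum>v\<in>S. scale (u v) v) = 0" "v \<in> S"
    have "(\<Sum>v\<in>S. u v * v x) = 0" for x
      using fun_cong[OF *(3), of x] by (simp add: sum_apply scale_def)
    from Gal_independent[where a = u, OF *(2,1) this *(4)] show "u v = 0" .
  qed
  ultimately show ?thesis
    using V.independent_span_bound B(1) by blast
qed

section \<open>Left spans\<close>

text \<open>Scalars act on the left because \<open>K[\<tau>]\<close> is not commutative. Adding one
  multiple at a time gives an induction rule for membership in the generated submodule.\<close>

inductive_set lspan :: "('a::ring_1 ^ 'n) set \<Rightarrow> ('a ^ 'n) set" for X where
  lspan_zero: "0 \<in> lspan X"
| lspan_step: "x \<in> X \<Longrightarrow> y \<in> lspan X \<Longrightarrow> p *s x + y \<in> lspan X"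

lemma lspan_add: "x \<in> lspan X \<Longrightarrow> y \<in> lspan X \<Longrightarrow> x + y \<in> lspan X"
  by (induction rule: lspan.induct) (auto simp: add.assoc intro: lspan_step)

lemma lspan_scale: "x \<in> lspan X \<Longrightarrow> p *s x \<in> lspan X"
  by (induction rule: lspan.induct)
     (auto simp: intro: lspan_zero lspan_step)

lemma lspan_base: "x \<in> X \<Longrightarrow> x \<in> lspan X"
  using lspan_step[OF _ lspan_zero, of x X 1] by simp

lemma lspan_sum: "(\<And>i. i \<in> A \<Longrightarrow> f i \<in> lspan X) \<Longrightarrow> (\<Sum>i\<in>A. f i) \<in> lspan X"
  by (induction A rule: infinite_finite_induct) (auto intro: lspan_zero lspan_add)

lemma lspan_subset:
  assumes "X \<subseteq> lspan Y"
  shows "lspan X \<subseteq> lspan Y"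
proof
  fix x assume "x \<in> lspan X"
  then show "x \<in> lspan Y"
    by induction (use assms in \<open>auto intro: lspan_zero lspan_add lspan_scale\<close>)
qed

lemma lspan_mono: "X \<subseteq> Y \<Longrightarrow> lspan X \<subseteq> lspan Y"
  by (intro lspan_subset) (auto intro: lspan_base)

lemma lspan_finite_support: "y \<in> lspan X \<Longrightarrow> \<exists>F. finite F \<and> F \<subseteq> X \<and> y \<in> lspan F"
proof (induction rule: lspan.induct)
  case lspan_zero
  then show ?case by (intro exI[of _ "{}"]) (auto intro: lspan.lspan_zero)
next
  case (lspan_step x y p)
  then obtain F where "finite F" "F \<subseteq> X" "y \<in> lspan F" by auto
  with lspan_step.hyps show ?case
    using lspan_mono[of F "insert x F"]
    by (intro exI[of _ "insert x F"]) (auto intro: lspan.lspan_step)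
qed

lemma lspan_explicit:
  assumes "finite X" "y \<in> lspan X"
  shows "\<exists>p. y = (\<Sum>x\<in>X. p x *s x)"
  using assms(2)
proof induction
  case lspan_zero
  then show ?case by (intro exI[of _ "\<lambda>_. 0"]) simp
next
  case (lspan_step x y p)
  then obtain r where r: "y = (\<Sum>x\<in>X. r x *s x)" by auto
  \<comment> \<open>The new multiple of \<open>x\<close> is merged with the coefficient that
    \<open>x\<close> may already have.\<close>
  have "(\<Sum>z\<in>X. ((if z = x then p else 0) + r z) *s z) = (\<Sum>z\<in>X. (if z = x then p *s x else 0)) + y"
    unfolding r sum.distrib[symmetric]
    by (intro sum.cong) auto
  also have "\<dots> = p *s x + y"
    using assms(1) lspan_step.hyps(1) by simp
  finally show ?case
    by (intro exI[of _ "\<lambda>z. (if z = x then p else 0) + r z"]) (rule sym)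
qed

section \<open>Skew polynomials\<close>

lemma skew_coeff_sum: "skew_coeff (\<Sum>x\<in>A. f x) n = (\<Sum>x\<in>A. skew_coeff (f x :: 'a::field_over_Fq skew_poly) n)"
  by (induction A rule: infinite_finite_induct) (auto simp: skew_coeff_add skew_coeff_zero)

lemma skew_const_simps: "skew_const 0 = (0 :: 'a::field_over_Fq skew_poly)" "skew_const 1 = (1 :: 'a skew_poly)"
  by (rule skew_poly_eqI; simp add: skew_coeff_const skew_coeff_zero skew_coeff_one)+

lemma skew_coeff_const_mult:
  "skew_coeff (skew_const a * p) n = a * skew_coeff (p :: 'a::field_over_Fq skew_poly) n"
proof -
  have "skew_coeff (skew_const a * p) n = (\<Sum>i\<le>n. if i = 0 then a * skew_coeff p n else 0)"
    unfolding skew_coeff_mult by (intro sum.cong) (auto simp: skew_coeff_const)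
  then show ?thesis by simp
qed

lemma skew_coeff_tau_mult:
  "skew_coeff (tau * p) n = (if n = 0 then 0 else frob (skew_coeff (p :: 'a::field_over_Fq skew_poly) (n - 1)))"
proof -
  have "skew_coeff (tau * p) n = (\<Sum>i\<le>n. if i = 1 then frob (skew_coeff p (n - 1)) else 0)"
    unfolding skew_coeff_mult by (intro sum.cong) (auto simp: skew_coeff_tau)
  then show ?thesis by auto
qed

lemma skew_coeff_tau_power_mult:
  "skew_coeff (tau ^ d * p) n =
     (if n < d then 0 else (frob ^^ d) (skew_coeff (p :: 'a::field_over_Fq skew_poly) (n - d)))"
proof (induction d arbitrary: n)
  case (Suc d)
  show ?case
    by (cases n) (simp_all add: mult.assoc skew_coeff_tau_mult Suc.IH)
qed simp

lemma skew_coeff_eventually_0: "\<exists>n. \<forall>m\<ge>n. skew_coeff p m = (0 :: 'a::zero)"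
proof transfer
  fix p :: "'a poly"
  show "\<exists>n. \<forall>m\<ge>n. coeff p m = 0"
    by (intro exI[of _ "Suc (degree p)"]) (auto intro: coeff_eq_0)
qed

context
  fixes \<sigma> :: "'a::field_over_Fq \<Rightarrow> 'a" and L
  assumes \<sigma>: "\<sigma> \<in> Gal L"
begin

private lemmas \<sigma>_simps =
  skew_coeff_map[where \<sigma> = \<sigma>, OF Gal_zero[OF \<sigma>]] Gal_zero[OF \<sigma>] Gal_one[OF \<sigma>] Gal_add[OF \<sigma>] Gal_mult[OF \<sigma>]
  Gal_sum[OF \<sigma>] Gal_funpow_frob[OF \<sigma>] skew_coeff_zero skew_coeff_one skew_coeff_add
  skew_coeff_mult skew_coeff_const skew_coeff_tau

lemma skew_map_add: "skew_map \<sigma> (p + r) = skew_map \<sigma> p + skew_map \<sigma> r"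
  by (rule skew_poly_eqI) (simp add: \<sigma>_simps)

lemma skew_map_mult: "skew_map \<sigma> (p * r) = skew_map \<sigma> p * skew_map \<sigma> r"
  by (rule skew_poly_eqI) (simp add: \<sigma>_simps)

lemma skew_map_zero: "skew_map \<sigma> 0 = 0"
  by (rule skew_poly_eqI) (simp add: \<sigma>_simps)

lemma skew_map_one: "skew_map \<sigma> 1 = 1"
  by (rule skew_poly_eqI) (simp add: \<sigma>_simps)

lemma skew_map_sum: "skew_map \<sigma> (\<Sum>x\<in>A. f x) = (\<Sum>x\<in>A. skew_map \<sigma> (f x))"
  by (induction A rule: infinite_finite_induct) (simp_all add: skew_map_add skew_map_zero)

lemma skew_map_const: "skew_map \<sigma> (skew_const a) = skew_const (\<sigma> a)"
  by (rule skew_poly_eqI) (simp add: \<sigma>_simps)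

lemma skew_map_tau_power: "skew_map \<sigma> (tau ^ d) = tau ^ d"
proof (induction d)
  case (Suc d)
  have "skew_map \<sigma> tau = tau"
    by (rule skew_poly_eqI) (simp add: \<sigma>_simps)
  with Suc show ?case by (simp add: skew_map_mult)
qed (simp add: skew_map_one)

lemma skew_map_comp:
  assumes "\<delta> \<in> Gal L"
  shows "skew_map (\<sigma> \<circ> \<delta>) p = skew_map \<sigma> (skew_map \<delta> p)"
proof (rule skew_poly_eqI)
  fix n
  have "(\<sigma> \<circ> \<delta>) 0 = 0"
    by (simp add: Gal_zero[OF \<sigma>] Gal_zero[OF assms])
  from skew_coeff_map[where \<sigma> = "\<sigma> \<circ> \<delta>", OF this] show "skew_coeff (skew_map (\<sigma> \<circ> \<delta>) p) n = skew_coeff (skew_map \<sigma> (skew_map \<delta> p)) n"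
    by (simp add: skew_coeff_map[where \<sigma> = \<delta>, OF Gal_zero[OF assms]] \<sigma>_simps)
qed

end

lemma skew_map_id: "skew_map id p = p"
  by (rule skew_poly_eqI) (simp add: skew_coeff_map[where \<sigma> = id])

section \<open>Leading coefficients and weights\<close>

lemma skew_lead:
  assumes "p \<noteq> (0 :: 'a::field_over_Fq skew_poly)"
  shows "\<exists>d. skew_coeff p d \<noteq> 0 \<and> (\<forall>i>d. skew_coeff p i = 0)"
  using assms
proof transfer
  fix p :: "'a poly"
  assume "p \<noteq> 0"
  then show "\<exists>d. coeff p d \<noteq> 0 \<and> (\<forall>i>d. coeff p i = 0)"
    by (intro exI[of _ "degree p"]) (auto intro: coeff_eq_0)
qed

text \<open>The weight is the degree plus 1, and 0 for the zero vector.\<close>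

definition vec_wt :: "'a::zero skew_poly ^ 'n \<Rightarrow> nat" where
  "vec_wt v = (LEAST n. \<forall>m\<ge>n. \<forall>j. skew_coeff (v $ j) m = 0)"

lemma skew_coeff_ge_vec_wt:
  assumes "vec_wt v \<le> m"
  shows "skew_coeff (v $ j) m = 0"
proof -
  obtain n where n: "\<And>j. \<forall>m\<ge>n j. skew_coeff (v $ j) m = 0"
    using choice[of "\<lambda>j n. \<forall>m\<ge>n. skew_coeff (v $ j) m = 0"] skew_coeff_eventually_0 by blast
  have "\<forall>m\<ge>Max (range n). \<forall>j. skew_coeff (v $ j) m = 0"
    using n by simp
  then have "\<forall>m\<ge>vec_wt v. \<forall>j. skew_coeff (v $ j) m = 0"
    unfolding vec_wt_def by (rule LeastI)
  with assms show ?thesis by blast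
qed

lemma vec_wt_le: "(\<And>m j. n \<le> m \<Longrightarrow> skew_coeff (v $ j) m = 0) \<Longrightarrow> vec_wt v \<le> n"
  unfolding vec_wt_def by (intro Least_le) auto

lemma vec_wt_pos:
  fixes v :: "'a::field_over_Fq skew_poly ^ 'n"
  assumes "v \<noteq> 0"
  shows "vec_wt v > 0"
proof (rule ccontr)
  assume "\<not> vec_wt v > 0"
  then have "v $ j = 0" for j
    by (intro skew_poly_eqI) (simp add: skew_coeff_ge_vec_wt skew_coeff_zero)
  with assms show False by (simp add: vec_eq_iff)
qed

text \<open>The functional \<open>f\<close> is linear for the structure of \<open>K\<close> as a vector space over its subfield
  \<open>frob\<^sup>e(K)\<close>, where this subfield is identified with \<open>K\<close>.\<close>

lemma frob_functional:
  fixes a :: "'a::field_over_Fq"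
  assumes "a \<noteq> 0"
  shows "\<exists>f. (\<forall>x y. f (x + y) = f x + f y) \<and> (\<forall>x y. f ((frob ^^ e) x * y) = x * f y) \<and> f a = 1"
proof -
  define scale :: "'a \<Rightarrow> 'a \<Rightarrow> 'a" where "scale x y = (frob ^^ e) x * y" for x y
  interpret V: vector_space scale
    by unfold_locales (auto simp: scale_def algebra_simps funpow_frob_add funpow_frob_mult)
  interpret P: vector_space_pair scale "(*) :: 'a \<Rightarrow> 'a \<Rightarrow> 'a"
    by unfold_locales
  have "V.independent {a}"
    using assms by (simp add: V.dependent_single)
  from P.linear_independent_extend[OF this, of "\<lambda>_. 1"] obtain f
    where f: "Vector_Spaces.linear scale (*) f" "f a = 1" by auto
  interpret f: Vector_Spaces.linear scale "(*)" f by (rule f(1))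
  show ?thesis
    using f(2) f.add f.scale by (auto simp: scale_def)
qed

text \<open>Reducing modulo the two-sided ideal generated by \<open>\<tau>\<close> turns a basis of \<open>K[\<tau>]\<^sup>d\<close> into one of \<open>K\<^sup>d\<close>,
  so bases have \<open>d\<close> elements.\<close>

lemma invertible_matrix_of_basis:
  fixes X :: "('k::field_over_Fq skew_poly ^ 'd) set"
  assumes X: "finite X" "lspan X = UNIV"
    and indep: "\<And>p. (\<Sum>x\<in>X. p x *s x) = 0 \<Longrightarrow> \<forall>x\<in>X. p x = 0"
  shows "\<exists>S :: 'k skew_poly ^ 'd ^ 'd. invertible S \<and> (\<forall>i. S $ i \<in> X)"
proof -
  \<comment> \<open>\<open>q\<close> expresses the standard basis through \<open>X\<close>; it will
    give the inverse of the matrix whose rows are the elements of \<open>X\<close>.\<close>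
  have "\<exists>p. axis j 1 = (\<Sum>x\<in>X. p x *s x)" for j
    using X by (intro lspan_explicit) auto
  then obtain q where q: "\<And>j. axis j 1 = (\<Sum>x\<in>X. q j x *s x)"
    using choice[of "\<lambda>j p. axis j 1 = (\<Sum>x\<in>X. p x *s x)"] by blast
  have QX: "(\<Sum>x\<in>X. q j x * x $ i) = (if i = j then 1 else 0)" for i j
    using arg_cong[OF q[of j], of "\<lambda>v. v $ i"] by (simp add: axis_def eq_commute)
  \<comment> \<open>Expanding \<open>x\<close> in the standard basis and then in \<open>X\<close>
    gives a second expression of \<open>x\<close> through \<open>X\<close>; independence forces its
    coefficients to be 1 at \<open>x\<close> and 0 elsewhere.\<close>
  have XQ: "(\<Sum>j\<in>UNIV. x $ j * q j x') = (if x' = x then 1 else 0)" if "x \<in> X" "x' \<in> X" for x x'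
  proof -
    define p where "p y = (\<Sum>j\<in>UNIV. x $ j * q j y) - (if y = x then 1 else 0)" for y
    have "(\<Sum>y\<in>X. p y *s y) $ i = 0" for i
    proof -
      have "(\<Sum>y\<in>X. p y *s y) $ i =
          (\<Sum>y\<in>X. \<Sum>j\<in>UNIV. x $ j * (q j y * y $ i)) - (\<Sum>y\<in>X. if y = x then x $ i else 0)"
        by (simp add: p_def left_diff_distrib sum_distrib_right mult.assoc flip: sum_subtractf)
           (auto intro!: sum.cong)
      also have "(\<Sum>y\<in>X. \<Sum>j\<in>UNIV. x $ j * (q j y * y $ i)) = (\<Sum>j\<in>UNIV. x $ j * (\<Sum>y\<in>X. q j y * y $ i))"
        unfolding sum_distrib_left by (rule sum.swap)
      also have "\<dots> = x $ i"
        by (simp add: QX if_distrib cong: if_cong)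
      finally show ?thesis using X(1) \<open>x \<in> X\<close> by simp
    qed
    then have "(\<Sum>y\<in>X. p y *s y) = 0" by (simp add: vec_eq_iff)
    from indep[OF this] \<open>x' \<in> X\<close> have "p x' = 0" by blast
    then show ?thesis by (simp add: p_def)
  qed

  \<comment> \<open>The constant coefficient is a ring homomorphism to \<open>K\<close>, since no
    Frobenius power enters in degree 0. It carries \<open>QX\<close> and \<open>XQ\<close> over to
    \<open>K\<close>.\<close>
  define const :: "'k skew_poly \<Rightarrow> 'k" where "const p = skew_coeff p 0" for p
  have const_mult: "const (p * r) = const p * const r" for p r
    by (simp add: const_def skew_coeff_mult)
  have const_sum: "const (\<Sum>x\<in>A. f x) = (\<Sum>x\<in>A. const (f x))" for A and f :: "'b \<Rightarrow> 'k skew_poly"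
    by (simp add: const_def skew_coeff_sum)
  have const_if: "const (if b then 1 else 0) = (if b then 1 else 0)" for b
    by (simp add: const_def skew_coeff_zero skew_coeff_one)
  define r where "r x = (\<chi> j. const (x $ j))" for x :: "'k skew_poly ^ 'd"
  have QX': "(\<Sum>x\<in>X. const (q j x) * r x $ i) = (if i = j then 1 else 0)" for i j
    using arg_cong[OF QX[of j i], of const]
    by (simp only: const_sum const_mult const_if r_def vec_lambda_beta)
  have XQ': "(\<Sum>j\<in>UNIV. r x $ j * const (q j x')) = (if x' = x then 1 else 0)"
    if "x \<in> X" "x' \<in> X" for x x'
    using arg_cong[OF XQ[OF that], of const]
    by (simp only: const_sum const_mult const_if r_def vec_lambda_beta)
  have inj: "inj_on r X"
  proof
    fix x y assume xy: "x \<in> X" "y \<in> X" "r x = r y"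
    have "(if y = x then 1 else 0 :: 'k) = 1"
      unfolding XQ'[OF xy(1,2), symmetric] xy(3) by (simp add: XQ'[OF xy(2,2)])
    then show "x = y" by (simp split: if_splits)
  qed
  have "vec.independent (r ` X)"
    unfolding vec.independent_explicit
  proof (intro conjI allI impI ballI)
    fix u v assume u: "(\<Sum>v\<in>r ` X. u v *s v) = 0" and v: "v \<in> r ` X"
    from v obtain x' where x': "x' \<in> X" "v = r x'" by auto
    have "(\<Sum>x\<in>X. u (r x) * r x $ j) = 0" for j
      using arg_cong[OF u, of "\<lambda>v. v $ j"] by (simp add: sum.reindex[OF inj])
    then have "0 = (\<Sum>j\<in>UNIV. (\<Sum>x\<in>X. u (r x) * r x $ j) * const (q j x'))" by simp
    also have "\<dots> = (\<Sum>x\<in>X. u (r x) * (\<Sum>j\<in>UNIV. r x $ j * const (q j x')))"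
      unfolding sum_distrib_left sum_distrib_right mult.assoc by (rule sum.swap)
    also have "\<dots> = (\<Sum>x\<in>X. if x = x' then u v else 0)"
      using x' by (intro sum.cong) (auto simp: XQ')
    also have "\<dots> = u v" using X(1) x'(1) by simp
    finally show "u v = 0" by simp
  qed (simp add: X(1))
  moreover have "vec.span (r ` X) = UNIV"
  proof -
    have "v \<in> vec.span (r ` X)" for v
    proof -
      have "axis j 1 = (\<Sum>x\<in>X. const (q j x) *s r x)" for j
        by (simp add: vec_eq_iff QX') (simp add: axis_def)
      then have "axis j 1 \<in> vec.span (r ` X)" for j
        by (simp add: vec.span_sum vec.span_scale vec.span_base)
      then have "(\<Sum>j\<in>UNIV. v $ j *s axis j 1) \<in> vec.span (r ` X)"
        by (intro vec.span_sum vec.span_scale)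
      then show ?thesis by (simp add: basis_expansion)
    qed
    then show ?thesis by blast
  qed
  \<comment> \<open>Invariance of dimension over the field \<open>K\<close> gives the size of
    \<open>X\<close>. Once \<open>X\<close> is indexed by \<open>'d\<close>, the identities
    \<open>XQ\<close> and \<open>QX\<close> say that \<open>S\<close> and \<open>T\<close> are
    mutually inverse.\<close>
  ultimately have "card (r ` X) = CARD('d)"
    by (metis vec.dim_eq_card_independent vec.dim_span vec_dim_card)
  then have "card X = CARD('d)" by (simp add: card_image[OF inj])
  then obtain h where h: "bij_betw h (UNIV :: 'd set) X"
    using finite_same_card_bij[OF finite X(1)] by auto
  have hX: "h i \<in> X" for i using h by (auto simp: bij_betw_def)
  have h_eq: "h i = h j \<longleftrightarrow> i = j" for i j
    by (rule inj_eq[OF bij_betw_imp_inj_on[OF h]])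
  define S :: "'k skew_poly ^ 'd ^ 'd" where "S = (\<chi> i. h i)"
  define T :: "'k skew_poly ^ 'd ^ 'd" where "T = (\<chi> j i. q j (h i))"
  have "(\<Sum>j\<in>UNIV. h i $ j * q j (h k)) = (if i = k then 1 else 0)" for i k
    unfolding XQ[OF hX hX] h_eq by simp
  then have "S ** T = mat 1"
    by (simp add: S_def T_def matrix_matrix_mult_def mat_def vec_eq_iff)
  moreover have "T ** S = mat 1"
  proof -
    have "(\<Sum>k\<in>UNIV. q j (h k) * h k $ i) = (if i = j then 1 else 0)" for i j
      using sum.reindex_bij_betw[OF h, of "\<lambda>x. q j x * x $ i"] by (simp add: QX)
    then show ?thesis
      by (auto simp: S_def T_def matrix_matrix_mult_def mat_def vec_eq_iff)
  qed
  ultimately have "invertible S" unfolding invertible_def by blast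
  then show ?thesis using hX by (intro exI[of _ S]) (simp add: S_def)
qed

section \<open>The twisted action\<close>

locale skew_cocycle =
  fixes L :: "'k::field_over_Fq set"
    and c :: "('k \<Rightarrow> 'k) \<Rightarrow> 'k skew_poly ^ 'd ^ 'd"
  assumes finite_G: "finite (Gal L)"
    and cocycle: "\<sigma> \<in> Gal L \<Longrightarrow> \<delta> \<in> Gal L \<Longrightarrow> c (\<sigma> \<circ> \<delta>) = map_matrix (skew_map \<sigma>) (c \<delta>) ** c \<sigma>"
    and c_id: "c id = mat 1"
begin

definition twist :: "('k \<Rightarrow> 'k) \<Rightarrow> 'k skew_poly ^ 'd \<Rightarrow> 'k skew_poly ^ 'd" where
  "twist \<sigma> v = (\<chi> j. \<Sum>i\<in>UNIV. skew_map \<sigma> (v $ i) * c \<sigma> $ i $ j)"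

definition fixed :: "('k skew_poly ^ 'd) set" where
  "fixed = {v. \<forall>\<sigma>\<in>Gal L. twist \<sigma> v = v}"

lemma twist_add: "\<sigma> \<in> Gal L \<Longrightarrow> twist \<sigma> (v + w) = twist \<sigma> v + twist \<sigma> w"
  by (simp add: twist_def vec_eq_iff skew_map_add distrib_right sum.distrib)

lemma twist_scale: "\<sigma> \<in> Gal L \<Longrightarrow> twist \<sigma> (p *s v) = skew_map \<sigma> p *s twist \<sigma> v"
  by (simp add: twist_def vec_eq_iff skew_map_mult sum_distrib_left mult.assoc)

lemma twist_zero: "\<sigma> \<in> Gal L \<Longrightarrow> twist \<sigma> 0 = 0"
  by (simp add: twist_def vec_eq_iff skew_map_zero)

lemma twist_sum: "\<sigma> \<in> Gal L \<Longrightarrow> twist \<sigma> (\<Sum>x\<in>A. f x) = (\<Sum>x\<in>A. twist \<sigma> (f x))"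
  by (induction A rule: infinite_finite_induct) (simp_all add: twist_add twist_zero)

lemma twist_id: "twist id v = v"
proof -
  have "(\<Sum>i\<in>UNIV. v $ i * (mat 1 :: 'k skew_poly ^ 'd ^ 'd) $ i $ j) = (\<Sum>i\<in>UNIV. if i = j then v $ i else 0)" for j
    by (intro sum.cong) (auto simp: mat_def)
  then show ?thesis
    by (simp add: twist_def c_id skew_map_id vec_eq_iff)
qed

text \<open>The order of the factors in the cocycle relation is the one that fits row vectors: both
  sides are \<open>\<sigma>(\<delta>(v)) \<sigma>(c \<delta>) c \<sigma>\<close>.\<close>

lemma twist_comp:
  assumes "\<sigma> \<in> Gal L" "\<delta> \<in> Gal L"
  shows "twist (\<sigma> \<circ> \<delta>) v = twist \<sigma> (twist \<delta> v)"
proof -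
  have "(\<Sum>i\<in>UNIV. skew_map \<sigma> (skew_map \<delta> (v $ i)) * (\<Sum>k\<in>UNIV. skew_map \<sigma> (c \<delta> $ i $ k) * c \<sigma> $ k $ j)) =
        (\<Sum>k\<in>UNIV. (\<Sum>i\<in>UNIV. skew_map \<sigma> (skew_map \<delta> (v $ i)) * skew_map \<sigma> (c \<delta> $ i $ k)) * c \<sigma> $ k $ j)" for j
    unfolding sum_distrib_left sum_distrib_right mult.assoc by (rule sum.swap)
  then show ?thesis
    by (simp add: twist_def vec_eq_iff cocycle[OF assms] matrix_matrix_mult_def map_matrix_def
        skew_map_comp[OF assms] skew_map_sum[OF assms(1)] skew_map_mult[OF assms(1)])
qed

section \<open>Galois descent for the twisted action\<close>

text \<open>The trace of the action: composing with \<open>\<sigma>\<close> on the left permutes the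
  summands.\<close>

lemma twist_average_fixed: "(\<Sum>\<delta>\<in>Gal L. twist \<delta> x) \<in> fixed"
proof -
  have "twist \<sigma> (\<Sum>\<delta>\<in>Gal L. twist \<delta> x) = (\<Sum>\<delta>\<in>Gal L. twist \<delta> x)" if \<sigma>: "\<sigma> \<in> Gal L" for \<sigma>
  proof -
    have "twist \<sigma> (\<Sum>\<delta>\<in>Gal L. twist \<delta> x) = (\<Sum>\<delta>\<in>Gal L. twist (\<sigma> \<circ> \<delta>) x)"
      by (simp add: twist_sum[OF \<sigma>] twist_comp[OF \<sigma>])
    also have "\<dots> = (\<Sum>\<delta>\<in>Gal L. twist \<delta> x)"
      by (rule sum.reindex_bij_betw[OF bij_betw_Gal_comp[OF \<sigma>]])
    finally show ?thesis .
  qed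
  then show ?thesis by (simp add: fixed_def)
qed

text \<open>Artin's argument: the functions \<open>f\<close> on the Galois group for which \<open>\<Sum>\<sigma>. f \<sigma> * \<sigma>(e) c\<^sub>\<sigma>\<close> always lies in
  the span of the fixed vectors form a set that contains 1 and is closed under multiplication with
  \<open>\<sigma> \<mapsto> \<sigma> b\<close> and with scalars, hence it contains the indicator function of the identity.\<close>

lemma lspan_fixed: "lspan fixed = UNIV"
proof -
  let ?P = "\<lambda>f. \<forall>e. (\<Sum>\<sigma>\<in>Gal L. skew_const (f \<sigma>) *s twist \<sigma> e) \<in> lspan fixed"
  have "?P (\<lambda>_. 1)"
    by (auto simp: skew_const_simps intro: lspan_base twist_average_fixed)
  moreover have "?P (\<lambda>\<sigma>. f \<sigma> * (u * \<sigma> b + w))" if f: "?P f" for f u w b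
  proof
    fix e
    \<comment> \<open>Replacing \<open>e\<close> by \<open>skew_const b *s e\<close> multiplies the
      term at \<open>\<sigma>\<close> by \<open>\<sigma> b\<close>, so the affine factor splits into
      two instances of \<open>f\<close>.\<close>
    have eq: "skew_const (f \<sigma> * (u * \<sigma> b + w)) *s twist \<sigma> e =
        skew_const u *s (skew_const (f \<sigma>) *s twist \<sigma> (skew_const b *s e)) +
        skew_const w *s (skew_const (f \<sigma>) *s twist \<sigma> e)" if "\<sigma> \<in> Gal L" for \<sigma>
      unfolding twist_scale[OF that] skew_map_const[OF that] vector_smult_assoc
        vector_sadd_rdistrib[symmetric]
      by (intro arg_cong2[where f = "(*s)"] refl skew_poly_eqI)
         (simp add: skew_coeff_const_mult mult.assoc skew_coeff_add skew_coeff_const algebra_simps)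
    have "(\<Sum>\<sigma>\<in>Gal L. skew_const (f \<sigma> * (u * \<sigma> b + w)) *s twist \<sigma> e) =
        skew_const u *s (\<Sum>\<sigma>\<in>Gal L. skew_const (f \<sigma>) *s twist \<sigma> (skew_const b *s e)) +
        skew_const w *s (\<Sum>\<sigma>\<in>Gal L. skew_const (f \<sigma>) *s twist \<sigma> e)"
      by (simp add: eq vec_eq_iff sum_distrib_left sum.distrib mult.assoc)
    also have "\<dots> \<in> lspan fixed"
      using f by (intro lspan_add lspan_scale) blast+
    finally show "(\<Sum>\<sigma>\<in>Gal L. skew_const (f \<sigma> * (u * \<sigma> b + w)) *s twist \<sigma> e) \<in> lspan fixed" .
  qed
  ultimately obtain h where h: "?P h" "h id = 1" "\<forall>\<delta>\<in>Gal L - {id}. h \<delta> = 0"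
    using interpolation_closed[of "Gal L - {id}" id ?P "\<lambda>_. 1"] finite_G by auto
  have "(\<Sum>\<sigma>\<in>Gal L. skew_const (h \<sigma>) *s twist \<sigma> e) = e" for e
    using h(2,3) by (subst sum.remove[OF finite_G Gal_id]) (simp add: skew_const_simps twist_id)
  with h(1) show ?thesis by (metis UNIV_eq_I)
qed

text \<open>Each of the finitely many standard basis vectors involves finitely many fixed vectors;
  together these still generate.\<close>

lemma finite_fixed_generators: "\<exists>X\<subseteq>fixed. finite X \<and> lspan X = UNIV"
proof -
  have "\<forall>j. \<exists>F. finite F \<and> F \<subseteq> fixed \<and> axis j 1 \<in> lspan F"
    by (intro allI lspan_finite_support) (simp add: lspan_fixed)
  then obtain F where F: "\<And>j. finite (F j)" "\<And>j. F j \<subseteq> fixed" "\<And>j. axis j 1 \<in> lspan (F j)"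
    by metis
  define X where "X = (\<Union>j. F j)"
  have "v \<in> lspan X" for v
  proof -
    have "v = (\<Sum>j\<in>UNIV. v $ j *s axis j 1)"
      by (simp add: vec_eq_iff axis_def if_distrib cong: if_cong)
    also have "\<dots> \<in> lspan X"
      by (intro lspan_sum lspan_scale subsetD[OF lspan_mono F(3)]) (auto simp: X_def)
    finally show ?thesis .
  qed
  then show ?thesis
    using F(1,2) by (intro exI[of _ X]) (auto simp: X_def)
qed

section \<open>Lowering the total weight of a dependent family\<close>

text \<open>The top coefficients of the relation satisfy \<open>\<Sum>x. \<sigma>(a\<^sub>x) u\<^sub>x\<^bsup>Q\<^esup> = 0\<close> for all \<open>\<sigma>\<close>, where
  \<open>Q\<close> is a power of \<open>q\<close>.  The functional above extracts \<open>Q\<close>-th roots, and the trace moves the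
  coefficients into the fixed field.\<close>

lemma fixed_reduction:
  assumes X: "finite X" "X \<subseteq> fixed" "0 \<notin> X"
    and rel: "(\<Sum>x\<in>X. p x *s x) = 0"
    and x0: "x0 \<in> X" "p x0 \<noteq> 0"
  shows "\<exists>k\<in>X. \<exists>y\<in>fixed. vec_wt y < vec_wt k \<and> k \<in> lspan (insert y (X - {k}))"
proof -
  \<comment> \<open>The degree of \<open>x\<close>; elements of \<open>X\<close> are nonzero, so the
    subtraction loses nothing.\<close>
  define D where "D x = vec_wt x - 1" for x :: "'k skew_poly ^ 'd"
  obtain d where d: "\<And>x. p x \<noteq> 0 \<Longrightarrow> skew_coeff (p x) (d x) \<noteq> 0"
    "\<And>x i. p x \<noteq> 0 \<Longrightarrow> i > d x \<Longrightarrow> skew_coeff (p x) i = 0"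
    using choice[of "\<lambda>x d. p x \<noteq> 0 \<longrightarrow> skew_coeff (p x) d \<noteq> 0 \<and> (\<forall>i>d. skew_coeff (p x) i = 0)"]
      skew_lead by blast
  define Y where "Y = {x\<in>X. p x \<noteq> 0}"
  have Y: "finite Y" "Y \<noteq> {}" using X(1) x0 by (auto simp: Y_def)
  \<comment> \<open>The largest degree of a product \<open>p x *s x\<close>, where the cancellation
    is read off.\<close>
  define n where "n = Max ((\<lambda>x. d x + D x) ` Y)"
  have n: "d x + D x \<le> n" if "x \<in> X" "p x \<noteq> 0" for x
    using that Y unfolding n_def Y_def by (intro Max_ge) auto
  \<comment> \<open>For \<open>x\<close> in \<open>X\<close> this is nonzero exactly when
    \<open>p x *s x\<close> reaches degree \<open>n\<close>. The guard makes
    \<open>D x \<le> n\<close> follow from \<open>a x \<noteq> 0\<close>.\<close>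
  define a where "a x = (if D x \<le> n then skew_coeff (p x) (n - D x) else 0)" for x
  define l where "l x j = skew_coeff (x $ j) (D x)" for x :: "'k skew_poly ^ 'd" and j
  have lead: "skew_coeff (skew_map \<sigma> (p x) * x $ j) n = \<sigma> (a x) * (frob ^^ (n - D x)) (l x j)"
    if x: "x \<in> X" and \<sigma>: "\<sigma> \<in> Gal L" for x \<sigma> j
  proof (cases "p x = 0")
    case True
    then have "a x = 0" by (simp add: a_def skew_coeff_zero)
    with True show ?thesis
      by (simp add: skew_map_zero[OF \<sigma>] Gal_zero[OF \<sigma>] skew_coeff_zero)
  next
    case False
    let ?t = "\<lambda>i. \<sigma> (skew_coeff (p x) i) * (frob ^^ i) (skew_coeff (x $ j) (n - i))"
    have le: "d x + D x \<le> n" using n x False by auto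
    have "?t i = 0" if "i \<le> n" "i \<noteq> n - D x" for i
    proof (cases "i > n - D x")
      case True
      then have "i > d x" using le by simp
      then show ?thesis by (simp add: d(2)[OF False] Gal_zero[OF \<sigma>])
    next
      case False
      then have "vec_wt x \<le> n - i" using that by (simp add: D_def)
      then show ?thesis by (simp add: skew_coeff_ge_vec_wt)
    qed
    then have "(\<Sum>i\<le>n. ?t i) = (\<Sum>i\<le>n. if i = n - D x then ?t i else 0)"
      by (intro sum.cong) auto
    then show ?thesis
      using le by (simp add: skew_coeff_mult skew_coeff_map[where \<sigma> = \<sigma>, OF Gal_zero[OF \<sigma>]] a_def l_def)
  qed
  \<comment> \<open>Each \<open>x\<close> is fixed, so twisting the relation changes only the
    coefficients \<open>p x\<close>.\<close>
  have E1: "(\<Sum>x\<in>X. \<sigma> (a x) * (frob ^^ (n - D x)) (l x j)) = 0" if \<sigma>: "\<sigma> \<in> Gal L" for \<sigma> j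
  proof -
    have "twist \<sigma> (\<Sum>x\<in>X. p x *s x) = (\<Sum>x\<in>X. skew_map \<sigma> (p x) *s x)"
      unfolding twist_sum[OF \<sigma>] twist_scale[OF \<sigma>]
      by (intro sum.cong refl) (use X(2) \<sigma> in \<open>auto simp: fixed_def\<close>)
    then have "(\<Sum>x\<in>X. skew_map \<sigma> (p x) *s x) $ j = 0"
      by (simp add: rel twist_zero[OF \<sigma>])
    then have "(\<Sum>x\<in>X. skew_coeff (skew_map \<sigma> (p x) * x $ j) n) = 0"
      by (simp add: skew_coeff_zero flip: skew_coeff_sum)
    then show ?thesis by (simp add: lead[OF _ \<sigma>])
  qed

  define I where "I = {x\<in>X. a x \<noteq> 0}"
  \<comment> \<open>Where the maximum \<open>n\<close> is attained, \<open>a x\<close> is the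
    leading coefficient of \<open>p x\<close>.\<close>
  have "n \<in> (\<lambda>x. d x + D x) ` Y"
    unfolding n_def using Y by (intro Max_in) auto
  then have "I \<noteq> {}"
    using d(1) by (force simp: I_def Y_def a_def)
  moreover have I: "finite I" "I \<subseteq> X" using X(1) by (auto simp: I_def)
  ultimately have "Max (D ` I) \<in> D ` I" by (intro Max_in) auto
  then obtain k where k: "k \<in> I" "Max (D ` I) = D k" by auto
  have Dk: "D x \<le> D k" if "x \<in> I" for x
    using that I(1) unfolding k(2)[symmetric] by (intro Max_ge) auto
  have "a k \<noteq> 0" using k(1) by (simp add: I_def)
  then have "D k \<le> n" by (auto simp: a_def split: if_splits)
  \<comment> \<open>Since \<open>D k\<close> is maximal on \<open>I\<close>, each exponent
    \<open>n - D x\<close> splits as \<open>e + (D k - D x)\<close>, and all terms share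
    \<open>frob ^^ e\<close>.\<close>
  define e where "e = n - D k"
  define u where "u x j = (frob ^^ (D k - D x)) (l x j)" for x j
  have E2: "(\<Sum>x\<in>I. \<sigma> (a x) * (frob ^^ e) (u x j)) = 0" if \<sigma>: "\<sigma> \<in> Gal L" for \<sigma> j
  proof -
    have "n - D x = e + (D k - D x)" if "x \<in> I" for x
      using Dk[OF that] \<open>D k \<le> n\<close> by (simp add: e_def)
    then have "(\<Sum>x\<in>I. \<sigma> (a x) * (frob ^^ e) (u x j)) = (\<Sum>x\<in>I. \<sigma> (a x) * (frob ^^ (n - D x)) (l x j))"
      by (intro sum.cong) (simp_all add: u_def funpow_add)
    also have "\<dots> = (\<Sum>x\<in>X. \<sigma> (a x) * (frob ^^ (n - D x)) (l x j))"
      using X(1) by (intro sum.mono_neutral_left) (auto simp: I_def Gal_zero[OF \<sigma>])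
    finally show ?thesis using E1[OF \<sigma>] by simp
  qed
  \<comment> \<open>Taking \<open>inv \<sigma>\<close> in \<open>E2\<close> and then applying
    \<open>\<sigma>\<close> moves the automorphism from the coefficients to the
    \<open>u x j\<close>, so that \<open>f\<close> will meet the same \<open>a x\<close> for every
    \<open>\<sigma>\<close>.\<close>
  have E3: "(\<Sum>x\<in>I. a x * (frob ^^ e) (\<sigma> (u x j))) = 0" if \<sigma>: "\<sigma> \<in> Gal L" for \<sigma> j
    using arg_cong[OF E2[OF Gal_inv[OF \<sigma>], of j], of \<sigma>]
    by (simp add: Gal_sum[OF \<sigma>] Gal_mult[OF \<sigma>] Gal_inv_apply[OF \<sigma>] Gal_funpow_frob[OF \<sigma>] Gal_zero[OF \<sigma>])

  obtain f where f: "\<And>x y. f (x + y) = f x + f y" "\<And>x y. f ((frob ^^ e) x * y) = x * f y" "f (a k) = 1"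
    using frob_functional[OF \<open>a k \<noteq> 0\<close>, of e] by metis
  have f_zero: "f 0 = 0" using f(1)[of 0 0] by (metis add.right_neutral add_left_cancel)
  have f_sum: "f (\<Sum>x\<in>A. h x) = (\<Sum>x\<in>A. f (h x))" for A and h :: "'k skew_poly ^ 'd \<Rightarrow> 'k"
    by (induction A rule: infinite_finite_induct) (simp_all add: f(1) f_zero)
  define b where "b x = f (a x)" for x
  have E4: "(\<Sum>x\<in>I. b x * \<sigma> (u x j)) = 0" if \<sigma>: "\<sigma> \<in> Gal L" for \<sigma> j
  proof -
    have "f (w * (frob ^^ e) v) = f w * v" for v w
      using f(2)[of v w] by (simp add: mult.commute)
    with arg_cong[OF E3[OF \<sigma>, of j], of f] show ?thesis
      unfolding f_sum f_zero by (simp add: b_def)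
  qed
  \<comment> \<open>The automorphism is moved back, to prepare for a trace of the
    \<open>b x\<close>.\<close>
  have E5: "(\<Sum>x\<in>I. \<sigma> (b x) * u x j) = 0" if \<sigma>: "\<sigma> \<in> Gal L" for \<sigma> j
    using arg_cong[OF E4[OF Gal_inv[OF \<sigma>], of j], of \<sigma>]
    by (simp add: Gal_sum[OF \<sigma>] Gal_mult[OF \<sigma>] Gal_inv_apply[OF \<sigma>] Gal_zero[OF \<sigma>])

  \<comment> \<open>A trace that vanishes everywhere would be a linear relation between
    automorphisms.\<close>
  have "\<exists>z. (\<Sum>\<sigma>\<in>Gal L. \<sigma> z) \<noteq> 0"
  proof (rule ccontr)
    assume "\<nexists>z. (\<Sum>\<sigma>\<in>Gal L. \<sigma> z) \<noteq> 0"
    then have "(\<Sum>\<sigma>\<in>Gal L. 1 * \<sigma> x) = 0" for x by simp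
    from Gal_independent[where a = "\<lambda>_. 1", OF finite_G subset_refl this Gal_id] show False by simp
  qed
  then obtain z where z: "(\<Sum>\<sigma>\<in>Gal L. \<sigma> z) \<noteq> 0" ..
  \<comment> \<open>The factor \<open>z\<close> makes \<open>tr 1\<close> nonzero; the plain trace
    of 1 is the group order, which may vanish in \<open>K\<close>.\<close>
  define tr where "tr w = (\<Sum>\<sigma>\<in>Gal L. \<sigma> (z * w))" for w
  have tr_fixed: "\<sigma> (tr w) = tr w" if \<sigma>: "\<sigma> \<in> Gal L" for \<sigma> w
    using sum.reindex_bij_betw[OF bij_betw_Gal_comp[OF \<sigma>], of "\<lambda>\<delta>. \<delta> (z * w)"]
    by (simp add: tr_def Gal_sum[OF \<sigma>])
  have "b k = 1" using f(3) by (simp add: b_def)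
  have "tr 1 \<noteq> 0" using z by (simp add: tr_def)
  \<comment> \<open>Weight \<open>E5\<close> by \<open>\<sigma> z\<close> and sum over the
    group.\<close>
  have E6: "(\<Sum>x\<in>I. tr (b x) * u x j) = 0" for j
  proof -
    have "(\<Sum>x\<in>I. tr (b x) * u x j) = (\<Sum>x\<in>I. \<Sum>\<sigma>\<in>Gal L. \<sigma> z * (\<sigma> (b x) * u x j))"
      unfolding tr_def sum_distrib_right
      by (intro sum.cong refl) (metis (no_types, lifting) Gal_mult mult.assoc)
    also have "\<dots> = (\<Sum>\<sigma>\<in>Gal L. \<sigma> z * (\<Sum>x\<in>I. \<sigma> (b x) * u x j))"
      unfolding sum_distrib_left by (rule sum.swap)
    finally show ?thesis by (simp add: E5)
  qed
  define g where "g x = tr (b x) * inverse (tr 1)" for x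
  have "g k = 1" using \<open>b k = 1\<close> \<open>tr 1 \<noteq> 0\<close> by (simp add: g_def)
  have g_fixed: "\<sigma> (g x) = g x" if \<sigma>: "\<sigma> \<in> Gal L" for \<sigma> x
    by (simp add: g_def Gal_mult[OF \<sigma>] Gal_inverse[OF \<sigma>] tr_fixed[OF \<sigma>])
  have E7: "(\<Sum>x\<in>I. g x * u x j) = 0" for j
    using E6[of j] by (simp add: g_def mult.commute mult.left_commute flip: sum_distrib_left)

  \<comment> \<open>Multiplying \<open>x\<close> in \<open>I\<close> by \<open>P x\<close> keeps it
    fixed and shifts its top coefficients to degree \<open>D k\<close>, where they become
    \<open>g x * u x j\<close>; in \<open>y\<close> they cancel by \<open>E7\<close>. As
    \<open>P k = 1\<close>, the vector \<open>k\<close> can be recovered from \<open>y\<close> and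
    the others.\<close>
  define P where "P x = skew_const (g x) * tau ^ (D k - D x)" for x
  define y where "y = (\<Sum>x\<in>I. P x *s x)"
  have coeff_y: "skew_coeff (y $ j) m = (\<Sum>x\<in>I. g x * (if m < D k - D x then 0 else
      (frob ^^ (D k - D x)) (skew_coeff (x $ j) (m - (D k - D x)))))" for j m
    by (simp add: y_def P_def skew_coeff_sum mult.assoc skew_coeff_const_mult skew_coeff_tau_power_mult)
  have "vec_wt y \<le> D k"
  proof (rule vec_wt_le)
    fix m j assume m: "D k \<le> m"
    show "skew_coeff (y $ j) m = 0"
    proof (cases "m = D k")
      case True
      have "skew_coeff (y $ j) m = (\<Sum>x\<in>I. g x * u x j)"
        unfolding coeff_y True using Dk by (intro sum.cong) (auto simp: u_def l_def)
      then show ?thesis by (simp add: E7)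
    next
      case False
      have "vec_wt x \<le> m - (D k - D x)" if "x \<in> I" for x
        using m False Dk[OF that] by (simp add: D_def)
      then show ?thesis
        unfolding coeff_y by (intro sum.neutral) (auto simp: skew_coeff_ge_vec_wt)
    qed
  qed
  also have "D k < vec_wt k"
  proof -
    have "k \<noteq> 0" using k(1) I(2) X(3) by blast
    then show ?thesis using vec_wt_pos[of k] by (simp add: D_def)
  qed
  finally have "vec_wt y < vec_wt k" .
  moreover have "y \<in> fixed"
  proof -
    have "twist \<sigma> y = y" if \<sigma>: "\<sigma> \<in> Gal L" for \<sigma>
    proof -
      have "skew_map \<sigma> (P x) = P x" for x
        by (simp add: P_def skew_map_mult[OF \<sigma>] skew_map_const[OF \<sigma>] skew_map_tau_power[OF \<sigma>] g_fixed[OF \<sigma>])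
      moreover have "twist \<sigma> x = x" if "x \<in> I" for x
        using that I(2) X(2) \<sigma> by (auto simp: fixed_def)
      ultimately show ?thesis
        by (simp add: y_def twist_sum[OF \<sigma>] twist_scale[OF \<sigma>])
    qed
    then show ?thesis by (simp add: fixed_def)
  qed
  moreover have "k \<in> lspan (insert y (X - {k}))"
  proof -
    have "P k = 1"
      by (simp add: P_def \<open>g k = 1\<close> skew_const_simps)
    then have "y = k + (\<Sum>x\<in>I - {k}. P x *s x)"
      unfolding y_def by (subst sum.remove[OF I(1) k(1)]) simp
    moreover have "(- P x) *s x = - (P x *s x)" for x
      by (simp add: vec_eq_iff)
    ultimately have "k = 1 *s y + (\<Sum>x\<in>I - {k}. (- P x) *s x)"
      by (simp add: sum_negf)
    also have "\<dots> \<in> lspan (insert y (X - {k}))"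
      using I(2) by (intro lspan_add lspan_sum lspan_scale lspan_base) auto
    finally show ?thesis .
  qed
  ultimately show ?thesis using k(1) I(2) by blast
qed

lemma fixed_basis:
  obtains X where "X \<subseteq> fixed" "finite X" "lspan X = UNIV"
    "\<And>p. (\<Sum>x\<in>X. p x *s x) = 0 \<Longrightarrow> \<forall>x\<in>X. p x = 0"
proof -
  let ?Q = "\<lambda>X. finite X \<and> X \<subseteq> fixed \<and> lspan X = UNIV"
  let ?W = "\<lambda>X. \<Sum>x\<in>X. vec_wt x"
  obtain X\<^sub>0 where "?Q X\<^sub>0" using finite_fixed_generators by blast
  from ex_has_least_nat[of ?Q, OF this, of ?W] obtain X
    where X: "?Q X" and least: "\<And>X'. ?Q X' \<Longrightarrow> ?W X \<le> ?W X'" by blast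
  \<comment> \<open>Discarding 0 keeps the span and does not raise the total weight;
    \<open>fixed_reduction\<close> asks for nonzero vectors.\<close>
  define Z where "Z = X - {0}"
  have "X \<subseteq> lspan Z"
    by (auto simp: Z_def intro: lspan_base lspan_zero)
  then have Z: "finite Z" "Z \<subseteq> fixed" "0 \<notin> Z" "lspan Z = UNIV"
    using X lspan_subset[of X Z] by (auto simp: Z_def)
  have W_Z: "?W Z \<le> ?W X"
    unfolding Z_def using X by (intro sum_mono2) auto
  have "p x = 0" if rel: "(\<Sum>x\<in>Z. p x *s x) = 0" and x: "x \<in> Z" for p x
  proof (rule ccontr)
    assume "p x \<noteq> 0"
    from fixed_reduction[OF Z(1-3) rel x this] obtain k y where
      ky: "k \<in> Z" "y \<in> fixed" "vec_wt y < vec_wt k" "k \<in> lspan (insert y (Z - {k}))" by blast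
    define X' where "X' = insert y (Z - {k})"
    have "Z \<subseteq> lspan X'"
      using ky(4) by (auto simp: X'_def intro: lspan_base)
    then have "?Q X'"
      using Z ky(2) lspan_subset[of Z X'] by (auto simp: X'_def)
    then have "?W X \<le> ?W X'" by (rule least)
    \<comment> \<open>Only an inequality, since \<open>y\<close> may already lie in
      \<open>Z - {k}\<close>.\<close>
    also have "?W X' \<le> vec_wt y + ?W (Z - {k})"
      using Z(1) by (simp add: X'_def sum.insert_if)
    also have "\<dots> < vec_wt k + ?W (Z - {k})"
      using ky(3) by simp
    also have "\<dots> = ?W Z"
      using Z(1) ky(1) by (simp add: sum.remove)
    finally show False using W_Z by simp
  qed
  then show thesis
    by (intro that[OF Z(2,1,4)] ballI)
qed

end

section \<open>Splitting the cocycle by a basis of fixed vectors\<close>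

theorem proposition6p7:
  fixes L :: "'k::field_over_Fq set"
    and c :: "('k \<Rightarrow> 'k) \<Rightarrow> 'k skew_poly ^ 'd ^ 'd"
  assumes "finite_Galois_extension L"
    and "Fq \<subseteq> L"
    and "\<And>\<sigma>. \<sigma> \<in> Gal L \<Longrightarrow> invertible (c \<sigma>)"
    and "\<And>\<sigma> \<delta>. \<sigma> \<in> Gal L \<Longrightarrow> \<delta> \<in> Gal L \<Longrightarrow>
           c (\<sigma> \<circ> \<delta>) = map_matrix (skew_map \<sigma>) (c \<delta>) ** c \<sigma>"
  shows "\<exists>S :: 'k skew_poly ^ 'd ^ 'd. invertible S \<and>
           (\<forall>\<sigma>\<in>Gal L. c \<sigma> = matrix_inv (map_matrix (skew_map \<sigma>) S) ** S)"
proof -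
  \<comment> \<open>At the identity the cocycle relation makes \<open>c id\<close> idempotent; being
    invertible, it is the identity matrix.\<close>
  have id: "c id = mat 1"
  proof -
    obtain A where A: "A ** c id = mat 1"
      using assms(3)[OF Gal_id] unfolding invertible_def by blast
    have "map_matrix (skew_map id) (c id) = c id"
      by (simp add: map_matrix_def skew_map_id)
    with assms(4)[OF Gal_id Gal_id] have "c id ** c id = c id" by simp
    then have "A ** c id ** c id = A ** c id"
      by (simp add: matrix_mul_assoc[symmetric])
    then show ?thesis by (simp add: A)
  qed
  have fin: "finite (Gal L)"
    using assms(1) finite_Gal by (auto simp: finite_Galois_extension_def)
  interpret skew_cocycle L c
  proof
    fix \<sigma> \<delta> assume "\<sigma> \<in> Gal L" "\<delta> \<in> Gal L"
    then show "c (\<sigma> \<circ> \<delta>) = map_matrix (skew_map \<sigma>) (c \<delta>) ** c \<sigma>" by (rule assms(4))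
  qed (rule fin, rule id)
  obtain X where X: "X \<subseteq> fixed" "finite X" "lspan X = UNIV"
    "\<And>p. (\<Sum>x\<in>X. p x *s x) = 0 \<Longrightarrow> \<forall>x\<in>X. p x = 0"
    by (rule fixed_basis) blast
  from invertible_matrix_of_basis[OF X(2-4)] obtain S :: "'k skew_poly ^ 'd ^ 'd"
    where S: "invertible S" "\<And>i. S $ i \<in> X" by blast
  have "c \<sigma> = matrix_inv (map_matrix (skew_map \<sigma>) S) ** S" if \<sigma>: "\<sigma> \<in> Gal L" for \<sigma>
  proof -
    let ?M = "map_matrix (skew_map \<sigma>) :: 'k skew_poly ^ 'd ^ 'd \<Rightarrow> _"
    have M_mult: "?M (A ** B) = ?M A ** ?M B" for A B
      by (simp add: map_matrix_def matrix_matrix_mult_def vec_eq_iff skew_map_sum[OF \<sigma>] skew_map_mult[OF \<sigma>])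
    have M_one: "?M (mat 1) = mat 1"
      by (auto simp: map_matrix_def mat_def vec_eq_iff skew_map_one[OF \<sigma>] skew_map_zero[OF \<sigma>])
    obtain T where "S ** T = mat 1" "T ** S = mat 1"
      using S(1) unfolding invertible_def by blast
    then have "?M S ** ?M T = mat 1 \<and> ?M T ** ?M S = mat 1"
      by (simp add: M_one flip: M_mult)
    then have inv: "matrix_inv (?M S) ** ?M S = mat 1"
      unfolding matrix_inv_def by (rule someI2) blast
    have "twist \<sigma> (S $ i) = S $ i" for i
      using S(2)[of i] X(1) \<sigma> by (auto simp: fixed_def)
    \<comment> \<open>Read row by row, fixedness under the twist is the equation
      \<open>\<sigma>(S) c \<sigma> = S\<close>.\<close>
    then have "?M S ** c \<sigma> = S"
      by (simp add: twist_def vec_eq_iff map_matrix_def matrix_matrix_mult_def)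
    then have "matrix_inv (?M S) ** S = matrix_inv (?M S) ** ?M S ** c \<sigma>"
      by (simp add: matrix_mul_assoc[symmetric])
    then show ?thesis by (simp add: inv)
  qed
  with S(1) show ?thesis by blast
qed

end
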